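(* Let $m,n\ge1$, let $\alpha>0$ and $\beta\in[0,1)$, and let $W,A,B,C\in\mathbb R^{2\times2}$ satisfy the network/communication assumption of the context with $N=2$. Then there exist differentiable functions $f_1,f_2:\mathbb R^{m\times n}\to\mathbb R$, both bounded below and both satisfying, for some constant $L_*$, $\|\nabla f_i(X)-\nabla f_i(Y)\|_*\le L_*\|X-Y\|$ for all $X,Y\in\mathbb R^{m\times n}$, and a point $X^\dagger\in\mathbb R^{m\times n}$, such that the no-tracking variant of SUDA--Muon (defined in the context), run with exact gradients $G_i^k=\nabla f_i(X_i^k)$ from the consensus initialization $X_1^0=X_2^0=X^\dagger$ with $Y_1^0=Y_2^0=0$ and $M_i^0=G_i^0$, satisfies $$\bar X^k=\tfrac12(X_1^k+X_2^k)=X^\dagger\qquad\text{for all }k\ge0,$$ while $f=\frac12(f_1+f_2)$ has $\nabla f(X^\dagger)\ne0$. Consequently, for every $K\ge1$, $$\frac1K\sum_{k=0}^{K-1}\|\nabla f(\bar X^k)\|_*=\|\nabla f(X^\dagger)\|_*>0,$$ so the no-tracking variant does not guarantee that the averaged gradient nuclear norm at $\bar X^k$ vanishes over the class of smooth heterogeneous objectives.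
   Context: Notation. $\|\cdot\|$ and $\|\cdot\|_*$ are the operator and nuclear norms. A stacked variable is $\mathbf Z=\mathrm{col}\{Z_1,\dots,Z_N\}$ with blocks in $\mathbb R^{m\times n}$, on which an $N\times N$ matrix $P$ acts by $(P\mathbf Z)_i=\sum_jP_{ij}Z_j$. For $H\in\mathbb R^{m\times n}$ with reduced SVD $H=U\Sigma V^\top$, $\operatorname{msgn}(H)=UV^\top$ and $\operatorname{msgn}(0)=0$; on stacked variables it acts blockwise. Network/communication assumption. $W\in\mathbb R^{N\times N}$ is symmetric, doubly stochastic and primitive, with $\rho(W-\frac1N\mathbf 1\mathbf 1^\top)\in(0,1)$ ($\rho$ = spectral radius). $A,B,C\in\mathbb R^{N\times N}$ satisfy: $A,C$ are doubly stochastic; $B\mathbf Z=0$ iff $Z_1=\dots=Z_N$; $A$, $B^2$, $C$ are polynomials in $W$. No-tracking variant of SUDA--Muon (noiseless). Given $\mathbf X^0$, set $\mathbf Y^0=0$, $\mathbf M^0=\mathbf G^0$. For $k\ge0$, with $G_i^k=\nabla f_i(X_i^k)$: $\mathbf M^{k+1}=\beta\mathbf M^k+(1-\beta)\mathbf G^k$; $\mathbf H^{k+1}=\mathbf M^{k+1}$; $\mathbf X^{k+1}=A(C\mathbf X^k-\alpha\operatorname{msgn}(\mathbf H^{k+1}))-B\mathbf Y^k$; $\mathbf Y^{k+1}=\mathbf Y^k+B\mathbf X^{k+1}$. *)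

theory Defs
  imports "HOL-Analysis.Analysis" "HOL-Computational_Algebra.Polynomial"
begin

definition outer :: "real^'m \<Rightarrow> real^'n \<Rightarrow> real^'n^'m" where
  "outer u v = (\<chi> i j. u $ i * v $ j)"

text \<open>
  The rank \<open>r\<close> is not a type, so the columns of \<open>U\<close> and \<open>V\<close> and the diagonal of \<open>\<Sigma>\<close> are
  families of which only the indices below \<open>r\<close> matter. The condition \<open>s i > 0\<close> makes the
  decomposition reduced; the zero matrix only has the decomposition with \<open>r = 0\<close>.
\<close>

definition reduced_svd ::
  "real^'n^'m \<Rightarrow> nat \<Rightarrow> (nat \<Rightarrow> real^'m) \<Rightarrow> (nat \<Rightarrow> real) \<Rightarrow> (nat \<Rightarrow> real^'n) \<Rightarrow> bool" where
  "reduced_svd H r u s v \<longleftrightarrow>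
     (\<forall>i<r. s i > 0) \<and>
     (\<forall>i<r. \<forall>j<r. u i \<bullet> u j = (if i = j then 1 else 0)) \<and>
     (\<forall>i<r. \<forall>j<r. v i \<bullet> v j = (if i = j then 1 else 0)) \<and>
     H = (\<Sum>i<r. s i *\<^sub>R outer (u i) (v i))"

text \<open>
  A reduced singular value decomposition always exists, and the two quantities below do not
  depend on which one is taken. In particular \<open>msgn 0 = 0\<close>.
\<close>

definition msgn :: "real^'n^'m \<Rightarrow> real^'n^'m" where
  "msgn H = (THE P. \<exists>r u s v. reduced_svd H r u s v \<and> P = (\<Sum>i<r. outer (u i) (v i)))"

definition nuclear_norm :: "real^'n^'m \<Rightarrow> real" where
  "nuclear_norm H = (THE t. \<exists>r u s v. reduced_svd H r u s v \<and> t = (\<Sum>i<r. s i))"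

definition op_norm :: "real^'n^'m \<Rightarrow> real" where
  "op_norm H = onorm (\<lambda>x. H *v x)"

text \<open>For matrix arguments the inner product in \<^const>\<open>gderiv\<close> is the trace inner product.\<close>

definition gradient :: "('a::real_inner \<Rightarrow> real) \<Rightarrow> 'a \<Rightarrow> 'a" where
  "gradient f x = (THE D. GDERIV f x :> D)"

text \<open>The overloaded power on \<^typ>\<open>real^'n^'n\<close> is entrywise, so it is not usable here.\<close>

primrec mat_power :: "real^'N^'N \<Rightarrow> nat \<Rightarrow> real^'N^'N" where
  "mat_power W 0 = mat 1"
| "mat_power W (Suc k) = W ** mat_power W k"

definition polynomial_in :: "real^'N^'N \<Rightarrow> real^'N^'N \<Rightarrow> bool" where
  "polynomial_in W P \<longleftrightarrow>
     (\<exists>p :: real poly. P = (\<Sum>k\<le>degree p. coeff p k *\<^sub>R mat_power W k))"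

definition doubly_stochastic :: "real^'N^'N \<Rightarrow> bool" where
  "doubly_stochastic P \<longleftrightarrow>
     (\<forall>i j. P $ i $ j \<ge> 0) \<and> (\<forall>i. (\<Sum>j\<in>UNIV. P $ i $ j) = 1) \<and>
     (\<forall>j. (\<Sum>i\<in>UNIV. P $ i $ j) = 1)"

definition primitive_matrix :: "real^'N^'N \<Rightarrow> bool" where
  "primitive_matrix P \<longleftrightarrow>
     (\<forall>i j. P $ i $ j \<ge> 0) \<and> (\<exists>k\<ge>1. \<forall>i j. mat_power P k $ i $ j > 0)"

definition complex_eigenvalue :: "real^'N^'N \<Rightarrow> complex \<Rightarrow> bool" where
  "complex_eigenvalue P c \<longleftrightarrow>
     (\<exists>x :: complex^'N. x \<noteq> 0 \<and> map_matrix complex_of_real P *v x = c *s x)"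

definition spectral_radius :: "real^'N^'N \<Rightarrow> real" where
  "spectral_radius P = Max (cmod ` {c. complex_eigenvalue P c})"

text \<open>A stacked variable \<open>col {Z\<^sub>1, \<dots>, Z\<^sub>N}\<close> is a vector of blocks indexed by \<open>'N\<close>.\<close>

definition block_apply :: "real^'N^'N \<Rightarrow> (real^'n^'m)^'N \<Rightarrow> (real^'n^'m)^'N"
    (infixr \<open>\<odot>\<close> 75) where
  "P \<odot> Z = (\<chi> i. \<Sum>j\<in>UNIV. P $ i $ j *\<^sub>R Z $ j)"

definition block_msgn :: "(real^'n^'m)^'N \<Rightarrow> (real^'n^'m)^'N" where
  "block_msgn Z = (\<chi> i. msgn (Z $ i))"

definition block_gradient ::
  "('N \<Rightarrow> real^'n^'m \<Rightarrow> real) \<Rightarrow> (real^'n^'m)^'N \<Rightarrow> (real^'n^'m)^'N" where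
  "block_gradient f Z = (\<chi> i. gradient (f i) (Z $ i))"

text \<open>
  The state after \<open>k\<close> iterations is the triple of \<open>X\<close>, \<open>Y\<close> and \<open>M\<close> with superscript \<open>k\<close>.
\<close>

primrec no_tracking_suda_muon ::
  "real^'N^'N \<Rightarrow> real^'N^'N \<Rightarrow> real^'N^'N \<Rightarrow> real \<Rightarrow> real \<Rightarrow>
   ('N \<Rightarrow> real^'n^'m \<Rightarrow> real) \<Rightarrow> (real^'n^'m)^'N \<Rightarrow> nat \<Rightarrow>
   ((real^'n^'m)^'N) \<times> ((real^'n^'m)^'N) \<times> ((real^'n^'m)^'N)" where
  "no_tracking_suda_muon A B C \<alpha> \<beta> f X0 0 = (X0, 0, block_gradient f X0)"
| "no_tracking_suda_muon A B C \<alpha> \<beta> f X0 (Suc k) =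
     (let (X, Y, M) = no_tracking_suda_muon A B C \<alpha> \<beta> f X0 k;
          M' = \<beta> *\<^sub>R M + (1 - \<beta>) *\<^sub>R block_gradient f X;
          H' = M';
          X' = A \<odot> (C \<odot> X - \<alpha> *\<^sub>R block_msgn H') - B \<odot> Y;
          Y' = Y + B \<odot> X'
      in (X', Y', M'))"

definition iterate_X ::
  "real^'N^'N \<Rightarrow> real^'N^'N \<Rightarrow> real^'N^'N \<Rightarrow> real \<Rightarrow> real \<Rightarrow>
   ('N \<Rightarrow> real^'n^'m \<Rightarrow> real) \<Rightarrow> (real^'n^'m)^'N \<Rightarrow> nat \<Rightarrow> (real^'n^'m)^'N" where
  "iterate_X A B C \<alpha> \<beta> f X0 k = fst (no_tracking_suda_muon A B C \<alpha> \<beta> f X0 k)"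

end

theory Submission
  imports Defs
begin

text \<open>
  The two objectives are \<open>arctan\<close> and \<open>-2 arctan\<close> of one fixed matrix entry. The derivative of
  \<open>arctan\<close> has constant sign, so the momenta of the two agents are always a positive and a negative
  multiple of the same matrix unit. Their matrix signs are therefore opposite and cancel in the
  average, although the gradients do not. The remaining operations preserve the average: \<open>A\<close>
  and \<open>C\<close> have unit column sums, and \<open>Y\<close> stays in the range of \<open>B\<close>, so that only \<open>B\<^sup>2\<close>
  contributes. This matrix is symmetric, being a polynomial in \<open>W\<close>, and annihilates consensus, so its
  column sums vanish.
\<close>

section \<open>Singular values of matrices of rank at most one\<close>

lemma norm_outer: "norm (outer u v) = norm u * norm v"
proof -
  have "outer u v $ i = u $ i *\<^sub>R v" for i
    by (simp add: outer_def vec_eq_iff)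
  then have "norm (outer u v) = L2_set (\<lambda>i. norm (u $ i *\<^sub>R v)) UNIV"
    by (simp add: norm_vec_def[of "outer u v"])
  also have "\<dots> = norm u * norm v"
    by (simp add: L2_set_left_distrib norm_vec_def[of u])
  finally show ?thesis .
qed

lemma outer_mult_vec: "outer u v *v w = (v \<bullet> w) *\<^sub>R u"
  by (simp add: vec_eq_iff outer_def matrix_vector_mult_def inner_vec_def sum_distrib_left mult_ac)

lemma sum_mult_vec: "(\<Sum>i\<in>S. M i) *v x = (\<Sum>i\<in>S. M i *v (x :: real^'n))"
  by (induction S rule: infinite_finite_induct) (simp_all add: matrix_vector_mult_add_rdistrib)

lemma scaleR_mult_vec: "(c *\<^sub>R M) *v x = c *\<^sub>R (M *v (x :: real^'n))"
  by (simp add: vec_eq_iff matrix_vector_mult_def sum_distrib_left mult_ac)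

lemma reduced_svd_mult_vec:
  assumes "reduced_svd H r u s v" "k < r"
  shows "H *v v k = s k *\<^sub>R u k"
proof -
  have "H *v v k = (\<Sum>i<r. s i *\<^sub>R ((v i \<bullet> v k) *\<^sub>R u i))"
    using assms(1) by (simp add: reduced_svd_def sum_mult_vec scaleR_mult_vec outer_mult_vec)
  also have "\<dots> = (\<Sum>i<r. if i = k then s k *\<^sub>R u k else 0)"
    using assms by (intro sum.cong) (auto simp: reduced_svd_def)
  finally show ?thesis using assms(2) by simp
qed

text \<open>Uniqueness for the definite descriptions in \<open>msgn\<close> and
  \<open>nuclear_norm\<close>. Each \<open>s i *\<^sub>R u i\<close> is the image of
  \<open>v i\<close>, hence a nonzero multiple of \<open>e\<close>. Two such multiples are never
  orthogonal, so at most one singular value remains, and comparing Frobenius norms determines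
  it.\<close>

lemma reduced_svd_rank_one:
  assumes svd: "reduced_svd (c *\<^sub>R outer e e') r u s v"
    and unit: "norm e = 1" "norm e' = 1"
  shows "(\<Sum>i<r. s i) = \<bar>c\<bar>" "(\<Sum>i<r. outer (u i) (v i)) = sgn c *\<^sub>R outer e e'"
proof -
  have pos: "s i > 0" if "i < r" for i using svd that by (auto simp: reduced_svd_def)
  have par: "s i *\<^sub>R u i = (c * (e' \<bullet> v i)) *\<^sub>R e" if "i < r" for i
    using reduced_svd_mult_vec[OF svd that] by (simp add: scaleR_mult_vec outer_mult_vec)
  have unit_uv: "norm (u i) = 1" "norm (v i) = 1" if "i < r" for i
    using svd that by (auto simp: reduced_svd_def norm_eq_1)
  have nz: "c * (e' \<bullet> v i) \<noteq> 0" if "i < r" for i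
    using par[OF that] pos[OF that] unit_uv[OF that] by (metis norm_zero scaleR_eq_0_iff order_less_irrefl zero_neq_one)
  have "r \<le> 1"
  proof (rule ccontr)
    assume "\<not> r \<le> 1"
    then have lt: "0 < r" "1 < r" by auto
    have "(s 0 *\<^sub>R u 0) \<bullet> (s 1 *\<^sub>R u 1) = 0" using svd lt by (auto simp: reduced_svd_def)
    then show False
      using nz lt unit by (simp add: par norm_eq_1)
  qed
  then consider "r = 0" | "r = 1" by linarith
  then have "(\<Sum>i<r. s i) = \<bar>c\<bar> \<and> (\<Sum>i<r. outer (u i) (v i)) = sgn c *\<^sub>R outer e e'"
  proof cases
    case 1
    then have "c *\<^sub>R outer e e' = 0" using svd by (simp add: reduced_svd_def)
    moreover have "outer e e' \<noteq> 0" using unit norm_outer[of e e'] by auto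
    ultimately show ?thesis using 1 by simp
  next
    case 2
    then have H: "c *\<^sub>R outer e e' = s 0 *\<^sub>R outer (u 0) (v 0)"
      using svd by (simp add: reduced_svd_def)
    have "norm (c *\<^sub>R outer e e') = norm (s 0 *\<^sub>R outer (u 0) (v 0))" by (simp only: H)
    then have s0: "s 0 = \<bar>c\<bar>" using unit unit_uv[of 0] pos[of 0] 2 by (simp add: norm_outer)
    have "outer (u 0) (v 0) = (1 / s 0) *\<^sub>R (s 0 *\<^sub>R outer (u 0) (v 0))"
      using pos[of 0] 2 by simp
    also have "\<dots> = (c / \<bar>c\<bar>) *\<^sub>R outer e e'"
      unfolding H[symmetric] by (simp add: s0)
    finally show ?thesis using 2 s0 by (simp add: real_sgn_eq)
  qed
  then show "(\<Sum>i<r. s i) = \<bar>c\<bar>" "(\<Sum>i<r. outer (u i) (v i)) = sgn c *\<^sub>R outer e e'"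
    by auto
qed

lemma reduced_svd_rank_one_exists:
  assumes "norm e = 1" "norm e' = 1"
  shows "\<exists>r u s v. reduced_svd (c *\<^sub>R outer e e') r u s v"
proof (cases "c = 0")
  case True
  then have "reduced_svd (c *\<^sub>R outer e e') 0 u s v" for u s v by (simp add: reduced_svd_def)
  then show ?thesis by blast
next
  case False
  \<comment> \<open>Singular values must be positive, so the sign of \<open>c\<close> moves into the
    left singular vector.\<close>
  have "c *\<^sub>R outer e e' = \<bar>c\<bar> *\<^sub>R outer (sgn c *\<^sub>R e) e'"
    by (simp add: vec_eq_iff outer_def mult.assoc[symmetric] abs_mult_sgn)
  then have "reduced_svd (c *\<^sub>R outer e e') 1 (\<lambda>_. sgn c *\<^sub>R e) (\<lambda>_. \<bar>c\<bar>) (\<lambda>_. e')"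
    using False assms by (auto simp: reduced_svd_def norm_eq_1 sgn_if)
  then show ?thesis by blast
qed

lemma
  assumes "norm e = 1" "norm e' = 1"
  shows msgn_rank_one: "msgn (c *\<^sub>R outer e e') = sgn c *\<^sub>R outer e e'"
    and nuclear_norm_rank_one: "nuclear_norm (c *\<^sub>R outer e e') = \<bar>c\<bar>"
proof -
  obtain r u s v where svd: "reduced_svd (c *\<^sub>R outer e e') r u s v"
    using reduced_svd_rank_one_exists[OF assms] by blast
  note one = reduced_svd_rank_one[OF _ assms]
  show "msgn (c *\<^sub>R outer e e') = sgn c *\<^sub>R outer e e'"
    unfolding msgn_def using svd one(2)
    by (intro the_equality exI[of _ r] exI[of _ u] exI[of _ s] exI[of _ v]) auto
  show "nuclear_norm (c *\<^sub>R outer e e') = \<bar>c\<bar>"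
    unfolding nuclear_norm_def using svd one(1)
    by (intro the_equality exI[of _ r] exI[of _ u] exI[of _ s] exI[of _ v]) auto
qed

text \<open>The entry is a coordinate of the image of a unit basis vector. The objectives depend on
  a single entry, so this is how the operator norm enters their smoothness bound.\<close>

lemma abs_entry_le_op_norm: "\<bar>M $ a $ b\<bar> \<le> op_norm M"
proof -
  have "\<bar>M $ a $ b\<bar> = \<bar>(M *v axis b 1) $ a\<bar>"
    by (simp add: matrix_vector_mult_basis column_def)
  also have "\<dots> \<le> norm (M *v axis b 1)" by (rule component_le_norm_cart)
  also have "\<dots> \<le> op_norm M"
    using onorm[OF matrix_vector_mul_bounded_linear, of M "axis b 1"] by (simp add: op_norm_def)
  finally show ?thesis .
qed

section \<open>Mixing matrices acting on stacked variables\<close>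

lemma block_apply_add: "P \<odot> (Y + Z) = P \<odot> Y + P \<odot> Z"
  by (simp add: vec_eq_iff block_apply_def sum.distrib distrib_left)

lemma block_apply_zero: "P \<odot> 0 = 0"
  by (simp add: vec_eq_iff block_apply_def)

lemma block_apply_mult: "P \<odot> Q \<odot> Z = (P ** Q) \<odot> Z"
proof -
  have "(\<Sum>j\<in>UNIV. P $ i $ j * (\<Sum>k\<in>UNIV. Q $ j $ k * Z $ k $ a $ b)) =
      (\<Sum>k\<in>UNIV. (\<Sum>j\<in>UNIV. P $ i $ j * Q $ j $ k) * Z $ k $ a $ b)" for i a b
    unfolding sum_distrib_left sum_distrib_right by (subst sum.swap) (simp add: mult.assoc)
  then show ?thesis
    by (simp add: vec_eq_iff block_apply_def matrix_matrix_mult_def)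
qed

text \<open>Exchanging the two sums leaves column sums as coefficients. The case
  \<open>c = 1\<close> serves \<open>A\<close> and \<open>C\<close>, the case \<open>c = 0\<close>
  serves \<open>B ** B\<close>.\<close>

lemma sum_block_apply:
  assumes "\<And>j. (\<Sum>i\<in>UNIV. P $ i $ j) = c"
  shows "(\<Sum>i\<in>UNIV. (P \<odot> Z) $ i) = c *\<^sub>R (\<Sum>j\<in>UNIV. Z $ j)"
proof -
  have "(\<Sum>i\<in>UNIV. (P \<odot> Z) $ i) = (\<Sum>j\<in>UNIV. \<Sum>i\<in>UNIV. P $ i $ j *\<^sub>R Z $ j)"
    by (simp add: block_apply_def) (rule sum.swap)
  then show ?thesis
    by (simp add: scaleR_sum_left[symmetric] assms scaleR_sum_right)
qed

text \<open>Transposition moves the factor \<open>W\<close>, which the recursion puts on the left,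
  to the right; this moves it back.\<close>

lemma mat_power_commute: "mat_power W k ** W = W ** mat_power W k"
  by (induction k) (simp_all add: matrix_mul_assoc[symmetric])

lemma transpose_mat_power:
  assumes "transpose W = W"
  shows "transpose (mat_power W k) = mat_power W k"
  by (induction k) (simp_all add: assms matrix_transpose_mul mat_power_commute)

lemma transpose_polynomial_in:
  assumes "transpose W = W" "polynomial_in W P"
  shows "transpose P = P"
proof -
  obtain p where P: "P = (\<Sum>k\<le>degree p. coeff p k *\<^sub>R mat_power W k)"
    using assms(2) by (auto simp: polynomial_in_def)
  have "mat_power W k $ j $ i = mat_power W k $ i $ j" for k i j
    using arg_cong[OF transpose_mat_power[OF assms(1)], of "\<lambda>M. M $ i $ j" k]
    by (simp only: transpose_def vec_lambda_beta)
  then show ?thesis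
    by (simp add: P vec_eq_iff transpose_def)
qed

section \<open>Gradients\<close>

lemma gradient_eqI:
  assumes "GDERIV f x :> D"
  shows "gradient f x = D"
  unfolding gradient_def
proof (rule the_equality)
  show "GDERIV f x :> D" by (rule assms)
next
  fix D' assume "GDERIV f x :> D'"
  then have "(\<lambda>h. h \<bullet> D') = (\<lambda>h. h \<bullet> D)"
    using assms has_derivative_unique by (auto simp: gderiv_def)
  then show "D' = D" by (metis inner_commute vector_eq_rdot)
qed

lemma GDERIV_arctan_entry:
  fixes X :: "real^'n^'m"
  shows "GDERIV (\<lambda>X. c * arctan (X $ a $ b)) X
    :> (c / (1 + (X $ a $ b)\<^sup>2)) *\<^sub>R outer (axis a 1) (axis b 1)"
proof -
  have entry: "H \<bullet> outer (axis a 1) (axis b 1) = H $ a $ b" for H :: "real^'n^'m"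
  proof -
    have "outer (axis a 1) (axis b 1) = (axis a (axis b 1) :: real^'n^'m)"
      by (auto simp: vec_eq_iff outer_def axis_def)
    then show ?thesis by (simp add: inner_axis)
  qed
  have "((\<lambda>X::real^'n^'m. X $ a $ b) has_derivative (\<lambda>H. H $ a $ b)) (at X)"
    by (intro bounded_linear_imp_has_derivative bounded_linear_compose[OF bounded_linear_vec_nth]
        bounded_linear_vec_nth)
  then show ?thesis
    unfolding gderiv_def
    by (auto intro!: derivative_eq_intros simp: entry divide_inverse mult_ac)
qed

text \<open>The difference factors as \<open>t - s\<close> times a quotient with numerator
  \<open>s + t\<close>. From 2|x| \<le> 1 + x^2 for both arguments, the quotient is at most 1 in
  absolute value.\<close>

lemma inverse_one_plus_square_lipschitz:
  fixes s t :: real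
  shows "\<bar>1 / (1 + s\<^sup>2) - 1 / (1 + t\<^sup>2)\<bar> \<le> \<bar>s - t\<bar>"
proof -
  have pos: "0 < 1 + s\<^sup>2" "0 < 1 + t\<^sup>2" by (simp_all add: add_pos_nonneg)
  have "\<bar>x\<bar> \<le> (1 + x\<^sup>2) / 2" for x :: real
    using zero_le_power2[of "\<bar>x\<bar> - 1"] by (simp add: power2_eq_square algebra_simps)
  then have "\<bar>s + t\<bar> \<le> (1 + s\<^sup>2) / 2 + (1 + t\<^sup>2) / 2"
    using abs_triangle_ineq[of s t] by (meson add_mono order_trans)
  also have "\<dots> \<le> (1 + s\<^sup>2) * (1 + t\<^sup>2)"
    by (simp add: field_simps)
  finally have bound: "\<bar>s + t\<bar> / ((1 + s\<^sup>2) * (1 + t\<^sup>2)) \<le> 1"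
    using pos by simp
  have "1 / (1 + s\<^sup>2) - 1 / (1 + t\<^sup>2) = (t - s) * ((s + t) / ((1 + s\<^sup>2) * (1 + t\<^sup>2)))"
    using pos by (simp add: field_simps power2_eq_square)
  then have "\<bar>1 / (1 + s\<^sup>2) - 1 / (1 + t\<^sup>2)\<bar> =
      \<bar>s - t\<bar> * (\<bar>s + t\<bar> / ((1 + s\<^sup>2) * (1 + t\<^sup>2)))"
    using pos by (simp add: abs_mult abs_minus_commute)
  also have "\<dots> \<le> \<bar>s - t\<bar> * 1" by (rule mult_left_mono[OF bound]) simp
  finally show ?thesis by simp
qed

theorem proposition5:
  fixes W A B C :: "real^2^2"
    and \<alpha> \<beta> :: real
  assumes "\<alpha> > 0"
    and "0 \<le> \<beta>" and "\<beta> < 1"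
    and "transpose W = W"
    and "doubly_stochastic W"
    and "primitive_matrix W"
    and "0 < spectral_radius (W - (1/2) *\<^sub>R (\<chi> i j. 1))"
    and "spectral_radius (W - (1/2) *\<^sub>R (\<chi> i j. 1)) < 1"
    and "doubly_stochastic A"
    and "doubly_stochastic C"
    and "\<And>Z :: (real^'n::finite^'m::finite)^2. B \<odot> Z = 0 \<longleftrightarrow> (\<forall>i j. Z $ i = Z $ j)"
    and "polynomial_in W A"
    and "polynomial_in W (B ** B)"
    and "polynomial_in W C"
  shows "\<exists>(f :: 2 \<Rightarrow> real^'n^'m \<Rightarrow> real) (Xd :: real^'n^'m).
     (\<forall>i X. f i differentiable (at X)) \<and>
     (\<forall>i. bdd_below (range (f i))) \<and>
     (\<exists>L. \<forall>i X Y. nuclear_norm (gradient (f i) X - gradient (f i) Y) \<le> L * op_norm (X - Y)) \<and>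
     (let favg = (\<lambda>X. (1/2) * (f 1 X + f 2 X));
          X = iterate_X A B C \<alpha> \<beta> f (\<chi> i. Xd);
          Xbar = (\<lambda>k. (1/2) *\<^sub>R (X k $ 1 + X k $ 2));
          avg = (\<lambda>K. (1 / real K) * (\<Sum>k<K. nuclear_norm (gradient favg (Xbar k))))
      in (\<forall>k. Xbar k = Xd) \<and>
         gradient favg Xd \<noteq> 0 \<and>
         (\<forall>K\<ge>1. avg K = nuclear_norm (gradient favg Xd)) \<and>
         nuclear_norm (gradient favg Xd) > 0 \<and>
         \<not> avg \<longlonglongrightarrow> 0)"
proof -
  \<comment> \<open>Any entry will do; index types are nonempty.\<close>
  obtain a :: 'm and b :: 'n where True by simp
  define E :: "real^'n^'m" where "E = outer (axis a 1) (axis b 1)"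
  \<comment> \<open>Opposite signs make the matrix signs cancel; unequal magnitudes keep the
    averaged gradient away from zero.\<close>
  define c :: "2 \<Rightarrow> real" where "c i = (if i = 1 then 1 else -2)" for i
  define f where "f i X = c i * arctan (X $ a $ b)" for i and X :: "real^'n^'m"
  define w where "w X = 1 / (1 + (X $ a $ b)\<^sup>2)" for X :: "real^'n^'m"
  have c: "c 1 = 1" "c 2 = -2" by (simp_all add: c_def)
  have w_pos: "w X > 0" for X by (simp add: w_def add_pos_nonneg)
  have msgn_E: "msgn (t *\<^sub>R E) = sgn t *\<^sub>R E" and nuclear_E: "nuclear_norm (t *\<^sub>R E) = \<bar>t\<bar>" for t
    unfolding E_def by (simp_all add: msgn_rank_one nuclear_norm_rank_one)
  have E: "E \<noteq> 0"
    using norm_outer[of "axis a 1 :: real^'m" "axis b 1 :: real^'n"] by (auto simp: E_def)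
  have grad_f: "gradient (f i) X = (c i * w X) *\<^sub>R E" for i X
    using gradient_eqI[OF GDERIV_arctan_entry] by (simp add: f_def[abs_def] w_def E_def)
  have diff_f: "f i differentiable (at X)" for i X
    using GDERIV_arctan_entry[of "c i" a b X]
    by (auto simp: f_def[abs_def] gderiv_def differentiable_def)
  have bdd_f: "bdd_below (range (f i))" for i
  proof (rule bdd_belowI2)
    fix X
    have "\<bar>f i X\<bar> \<le> \<bar>c i\<bar> * (pi / 2)"
      unfolding f_def abs_mult using arctan_bounded[of "X $ a $ b"]
      by (intro mult_left_mono) auto
    then show "- (\<bar>c i\<bar> * (pi / 2)) \<le> f i X" by linarith
  qed
  \<comment> \<open>The gradient difference is a multiple of \<open>E\<close>, so its nuclear norm
    is the absolute coefficient. The constant 2 is the larger of the two values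
    \<open>\<bar>c i\<bar>\<close>.\<close>
  have lip_f: "nuclear_norm (gradient (f i) X - gradient (f i) Y) \<le> 2 * op_norm (X - Y)" for i X Y
  proof -
    have "nuclear_norm (gradient (f i) X - gradient (f i) Y) = \<bar>c i\<bar> * \<bar>w X - w Y\<bar>"
      by (simp add: grad_f nuclear_E abs_mult[symmetric] right_diff_distrib
          flip: scaleR_left_diff_distrib)
    also have "\<dots> \<le> 2 * \<bar>(X - Y) $ a $ b\<bar>"
      using inverse_one_plus_square_lipschitz
      by (intro mult_mono) (auto simp: c_def w_def)
    also have "\<dots> \<le> 2 * op_norm (X - Y)"
      by (intro mult_left_mono abs_entry_le_op_norm) simp
    finally show ?thesis .
  qed
  have BB_col: "(\<Sum>i\<in>UNIV. (B ** B) $ i $ j) = 0" for j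
  proof -
    \<comment> \<open>A nonzero consensus stack: its annihilation says that the row sums of
      \<open>B ** B\<close> vanish, and symmetry turns these into column sums.\<close>
    define Z :: "(real^'n^'m)^2" where "Z = (\<chi> i. E)"
    have "(B ** B) \<odot> Z = 0"
      using assms(11)[of Z] by (simp add: block_apply_mult[symmetric] Z_def block_apply_zero)
    then have "((B ** B) \<odot> Z) $ j = 0" by simp
    then have "(\<Sum>i\<in>UNIV. (B ** B) $ j $ i) = 0"
      using E by (simp add: block_apply_def Z_def scaleR_sum_left[symmetric])
    moreover have "(B ** B) $ i $ j = (B ** B) $ j $ i" for i
      using arg_cong[OF transpose_polynomial_in[OF assms(4,13)], of "\<lambda>M. M $ j $ i"]
      by (simp only: transpose_def vec_lambda_beta)
    ultimately show ?thesis by simp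
  qed
  have A_sum: "(\<Sum>i\<in>UNIV. (A \<odot> Z) $ i) = (\<Sum>i\<in>UNIV. Z $ i)"
    and C_sum: "(\<Sum>i\<in>UNIV. (C \<odot> Z) $ i) = (\<Sum>i\<in>UNIV. Z $ i)" for Z :: "(real^'n^'m)^2"
    using assms(9,10) sum_block_apply[of _ 1 Z] by (auto simp: doubly_stochastic_def)
  \<comment> \<open>The stationary average is placed at the origin.\<close>
  define state where "state = no_tracking_suda_muon A B C \<alpha> \<beta> f (\<chi> i. 0)"
  \<comment> \<open>The weights \<open>p\<close> may differ between the agents and over time; only
    their positivity matters. \<open>S\<close> records that the second component lies in the range
    of \<open>B\<close>.\<close>
  have inv: "\<exists>X S p. state k = (X, B \<odot> S, \<chi> i. (c i * p i) *\<^sub>R E) \<and>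
      (\<Sum>i\<in>UNIV. X $ i) = 0 \<and> (\<forall>i. p i > 0)" for k
  proof (induction k)
    case 0
    have "state 0 = (\<chi> i. 0, B \<odot> 0, \<chi> i. (c i * w 0) *\<^sub>R E)"
      by (simp add: state_def block_gradient_def grad_f block_apply_zero)
    then show ?case using w_pos
      by (intro exI[of _ "\<chi> i. 0"] exI[of _ 0] exI[of _ "\<lambda>_. w 0"]) simp
  next
    case (Suc k)
    then obtain X S p where st: "state k = (X, B \<odot> S, \<chi> i. (c i * p i) *\<^sub>R E)"
      and X: "(\<Sum>i\<in>UNIV. X $ i) = 0" and p: "\<And>i. p i > 0" by blast
    define q where "q i = \<beta> * p i + (1 - \<beta>) * w (X $ i)" for i
    \<comment> \<open>The gradient term is strictly positive because \<open>\<beta> < 1\<close>; the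
      momentum term need only be nonnegative, which covers \<open>\<beta> = 0\<close>.\<close>
    have q: "q i > 0" for i
      using p[of i] w_pos[of "X $ i"] assms(2,3) by (simp add: q_def add_nonneg_pos)
    define M' where "M' = (\<chi> i. (c i * q i) *\<^sub>R E)"
    define X' where "X' = A \<odot> (C \<odot> X - \<alpha> *\<^sub>R block_msgn M') - B \<odot> B \<odot> S"
    have M': "\<beta> *\<^sub>R (\<chi> i. (c i * p i) *\<^sub>R E) + (1 - \<beta>) *\<^sub>R block_gradient f X = M'"
      by (simp add: M'_def q_def vec_eq_iff block_gradient_def grad_f algebra_simps)
    have "state (Suc k) = (X', B \<odot> S + B \<odot> X', M')"
      using st by (simp add: state_def Let_def M' X'_def)
    \<comment> \<open>Linearity absorbs the update of the second component into a new preimage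
      \<open>S + X'\<close>.\<close>
    then have "state (Suc k) = (X', B \<odot> (S + X'), \<chi> i. (c i * q i) *\<^sub>R E)"
      by (simp add: block_apply_add M'_def)
    moreover have "(\<Sum>i\<in>UNIV. X' $ i) = 0"
    proof -
      \<comment> \<open>Since \<open>q\<close> is positive, the two blocks have matrix signs
        \<open>E\<close> and \<open>- E\<close>.\<close>
      have "(\<Sum>i\<in>UNIV. block_msgn M' $ i) = 0"
        using q[of 1] q[of 2] by (simp add: block_msgn_def M'_def msgn_E sum_2 c sgn_mult)
      moreover have "(\<Sum>i\<in>UNIV. (B \<odot> B \<odot> S) $ i) = 0"
        using sum_block_apply[OF BB_col, of S] by (simp add: block_apply_mult)
      ultimately show ?thesis
        using X by (simp add: X'_def sum_subtractf A_sum C_sum flip: scaleR_sum_right)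
    qed
    ultimately show ?case using q by blast
  qed
  let ?X = "iterate_X A B C \<alpha> \<beta> f (\<chi> i. 0)"
  let ?favg = "\<lambda>X. (1/2) * (f 1 X + f 2 X)"
  have mean: "(1/2) *\<^sub>R (?X k $ 1 + ?X k $ 2) = 0" for k
    using inv[of k] by (auto simp: iterate_X_def state_def sum_2)
  \<comment> \<open>The factor is the mean of the coefficients 1 and -2.\<close>
  have "?favg = (\<lambda>X. (-1/2) * arctan (X $ a $ b))"
    by (simp add: f_def c)
  then have "gradient ?favg 0 = (-1/2) *\<^sub>R E"
    using gradient_eqI[OF GDERIV_arctan_entry[of "-1/2" a b 0]] by (simp add: E_def)
  then have grad: "gradient ?favg 0 \<noteq> 0" "nuclear_norm (gradient ?favg 0) = 1/2"
    using E by (simp_all only: nuclear_E) simp_all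
  let ?avg = "\<lambda>K. (1 / real K) * (\<Sum>k<K. nuclear_norm
    (gradient ?favg ((1/2) *\<^sub>R (?X k $ 1 + ?X k $ 2))))"
  have avg: "?avg K = 1/2" if "K \<ge> 1" for K
    using that by (simp only: mean grad) simp
  \<comment> \<open>At \<open>K = 0\<close> the average is 0 by the convention for division by zero,
    so the sequence is constant only from 1 on.\<close>
  have "?avg \<longlonglongrightarrow> 1/2"
    by (rule tendsto_eventually, rule eventually_sequentiallyI[of 1]) (rule avg)
  then have "\<not> ?avg \<longlonglongrightarrow> 0"
    using LIMSEQ_unique by fastforce
  then show ?thesis
    using diff_f bdd_f lip_f mean grad avg
    by (intro exI[of _ f] exI[of _ 0]) (auto simp only: Let_def)
qed

end
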